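(* Let $(X,+,\circ)$ be a skew brace and let $f:X\to X$ be a bijection such that $f(a-b+c)=f(a)-f(b)+f(c)$ for all $a,b,c\in X$. Let $\sigma^f_a,\tau^f_b:X\to X$ be given by either (i) $\sigma^f_a(b)=-f(a)+a\circ b$, where $f(a\circ b)=a\circ f(b)-a+f(a)$ for all $a,b\in X$; or (ii) $\sigma^f_a(b)=a\circ b-f(a)$, where $f(a\circ b)=f(a)-a+a\circ f(b)$ for all $a,b\in X$; and in both cases $\tau^f_b(a)=(\sigma^f_a(b))^{-1}\circ a\circ b$. Let $r:X\times X\to X\times X$ be the map $r(a,b)=(\sigma^f_a(b),\tau^f_b(a))$ for all $a,b\in X$. Then $r$ is a solution of the set-theoretic braid equation.
   Context: A left skew brace is a set $B$ with two group operations $+,\circ$ such that $a\circ(b+c)=a\circ b-a+a\circ c$ for all $a,b,c\in B$; a skew brace (in this paper) is a left skew brace that also satisfies $(b+c)\circ a=b\circ a-a+c\circ a$ for all $a,b,c$. The group $(B,+)$ need not be abelian. Inverses with respect to $\circ$ are written $x^{-1}$. A map $r:X\times X\to X\times X$ is a solution of the set-theoretic braid equation if $(r\times \mathrm{id}_X)(\mathrm{id}_X\times r)(r\times\mathrm{id}_X)=(\mathrm{id}_X\times r)(r\times\mathrm{id}_X)(\mathrm{id}_X\times r)$. *)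

theory Defs
  imports "HOL-Algebra.Ring"
begin

text \<open>
  A structure with two group operations on one carrier is encoded by the record type of rings:
  \<open>add\<close> is the (not necessarily commutative) operation written \<open>+\<close> in the theory of
  skew braces, and \<open>mult\<close> is the operation written \<open>\<circ>\<close>.  No ring axioms are assumed.
\<close>

locale left_skew_brace =
  fixes B :: "('a, 'm) ring_scheme" (structure)
  assumes add_group: "group (add_monoid B)"
    and circ_group: "group B"
    and left_distrib:
      "\<lbrakk>a \<in> carrier B; b \<in> carrier B; c \<in> carrier B\<rbrakk>
        \<Longrightarrow> a \<otimes> (b \<oplus> c) = a \<otimes> b \<ominus> a \<oplus> a \<otimes> c"

text \<open>Skew braces here are two-sided.\<close>

locale skew_brace = left_skew_brace +
  assumes right_distrib:
      "\<lbrakk>a \<in> carrier B; b \<in> carrier B; c \<in> carrier B\<rbrakk>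
        \<Longrightarrow> (b \<oplus> c) \<otimes> a = b \<otimes> a \<ominus> a \<oplus> c \<otimes> a"

definition apply12 :: "('a \<times> 'a \<Rightarrow> 'a \<times> 'a) \<Rightarrow> 'a \<times> 'a \<times> 'a \<Rightarrow> 'a \<times> 'a \<times> 'a" where
  "apply12 r = (\<lambda>(x, y, z). case r (x, y) of (u, v) \<Rightarrow> (u, v, z))"

definition apply23 :: "('a \<times> 'a \<Rightarrow> 'a \<times> 'a) \<Rightarrow> 'a \<times> 'a \<times> 'a \<Rightarrow> 'a \<times> 'a \<times> 'a" where
  "apply23 r = (\<lambda>(x, y, z). case r (y, z) of (v, w) \<Rightarrow> (x, v, w))"

definition braid_solution :: "'a set \<Rightarrow> ('a \<times> 'a \<Rightarrow> 'a \<times> 'a) \<Rightarrow> bool" where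
  "braid_solution X r \<longleftrightarrow>
     r \<in> X \<times> X \<rightarrow> X \<times> X \<and>
     (\<forall>t \<in> X \<times> X \<times> X.
        (apply12 r \<circ> apply23 r \<circ> apply12 r) t = (apply23 r \<circ> apply12 r \<circ> apply23 r) t)"

end

theory Submission
  imports Defs
begin

text \<open>
  In both cases \<open>\<sigma>\<close> is an action of the group \<open>(X, \<circ>)\<close> on the set \<open>X\<close>: the functional equation of \<open>f\<close>
  is exactly the condition under which the correction term \<open>f a\<close> propagates through products, so
  that \<open>\<sigma>\<^sub>a \<sigma>\<^sub>b = \<sigma>\<^sub>a\<^sub>\<circ>\<^sub>b\<close>.  The map \<open>\<tau>\<close> is defined so that \<open>r\<close> preserves the product, that is,
  \<open>\<sigma>\<^sub>a(b) \<circ> \<tau>\<^sub>b(a) = a \<circ> b\<close>.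

  Consider the two sides of the braid equation at \<open>(a, b, c)\<close>.  Since \<open>\<sigma>\<close> is an action and \<open>r\<close>
  preserves products, both sides have first entry \<open>\<sigma>\<^sub>a\<^sub>\<circ>\<^sub>b(c)\<close>, and the product of the three entries
  is \<open>a \<circ> b \<circ> c\<close> on both sides.  It remains to compare the third entries, or equivalently the
  products of the first two.  For the left-hand side this product is
  \<open>\<sigma>\<^sub>a(b) \<circ> \<sigma>\<^sub>v(c)\<close> with \<open>v = \<tau>\<^sub>b(a)\<close>, and the skew brace computation evaluates it to
  \<open>- f (f a) + a \<circ> b \<circ> c\<close> in the first case and to \<open>a \<circ> b \<circ> c - f (f a)\<close> in the second.  Thus it
  depends on \<open>b\<close> and \<open>c\<close> only through \<open>b \<circ> c\<close>.  The right-hand side arises from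
  \<open>r (b, c) = (s, t)\<close> in the same manner with \<open>s, t\<close> in place of \<open>b, c\<close>, and \<open>s \<circ> t = b \<circ> c\<close>,
  so the two products agree.

  By contrast \<open>\<sigma>\<^sub>a(b \<circ> c)\<close> has \<open>f a\<close> in place of \<open>f (f a)\<close>.  Since \<open>f\<close> is bijective, \<open>\<tau>\<close> is thus a
  right action only if \<open>f\<close> is the identity, and the classical criterion for braided groups
  does not apply in general.
\<close>

text \<open>
  The part of the argument that happens in a single group.  The function \<open>k\<close> records the product
  of the first two entries after \<open>r \<times> id\<close> followed by \<open>id \<times> r\<close>; that it sees only the
  product \<open>b \<otimes> c\<close> replaces the requirement that \<open>\<tau>\<close> be a right action.
\<close>

lemma (in group) braid_solution_of_action:
  fixes \<sigma> \<tau> k :: "'a \<Rightarrow> 'a \<Rightarrow> 'a"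
  assumes \<sigma>_closed: "\<And>a b. \<lbrakk>a \<in> carrier G; b \<in> carrier G\<rbrakk> \<Longrightarrow> \<sigma> a b \<in> carrier G"
    and action: "\<And>a b c. \<lbrakk>a \<in> carrier G; b \<in> carrier G; c \<in> carrier G\<rbrakk>
      \<Longrightarrow> \<sigma> a (\<sigma> b c) = \<sigma> (a \<otimes> b) c"
    and \<tau>: "\<And>a b. \<lbrakk>a \<in> carrier G; b \<in> carrier G\<rbrakk> \<Longrightarrow> \<tau> b a = inv (\<sigma> a b) \<otimes> a \<otimes> b"
    and product: "\<And>a b c. \<lbrakk>a \<in> carrier G; b \<in> carrier G; c \<in> carrier G\<rbrakk>
      \<Longrightarrow> \<sigma> a b \<otimes> \<sigma> (\<tau> b a) c = k a (b \<otimes> c)"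
    and r: "\<And>a b. \<lbrakk>a \<in> carrier G; b \<in> carrier G\<rbrakk> \<Longrightarrow> r (a, b) = (\<sigma> a b, \<tau> b a)"
  shows "braid_solution (carrier G) r"
proof -
  have \<tau>_closed: "\<tau> b a \<in> carrier G" if "a \<in> carrier G" "b \<in> carrier G" for a b
    using that by (simp add: \<tau> \<sigma>_closed)
  note closed = \<sigma>_closed \<tau>_closed
  have preserve: "\<sigma> a b \<otimes> \<tau> b a = a \<otimes> b" if "a \<in> carrier G" "b \<in> carrier G" for a b
    using that by (simp add: \<tau> \<sigma>_closed m_assoc[symmetric])
  have braid: "(apply12 r \<circ> apply23 r \<circ> apply12 r) (a, b, c)
      = (apply23 r \<circ> apply12 r \<circ> apply23 r) (a, b, c)"
    if abc: "a \<in> carrier G" "b \<in> carrier G" "c \<in> carrier G" for a b c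
  proof -
    define u v p where "u = \<sigma> a b" and "v = \<tau> b a" and "p = \<sigma> v c"
    define s t q where "s = \<sigma> b c" and "t = \<tau> c b" and "q = \<tau> s a"
    have mem: "u \<in> carrier G" "v \<in> carrier G" "p \<in> carrier G"
      "s \<in> carrier G" "t \<in> carrier G" "q \<in> carrier G"
      using abc by (simp_all add: u_def v_def p_def s_def t_def q_def closed)
    have uv: "u \<otimes> v = a \<otimes> b" and st: "s \<otimes> t = b \<otimes> c"
      using abc by (simp_all add: u_def v_def s_def t_def preserve)
    have first: "\<sigma> u p = \<sigma> a s"
      unfolding p_def s_def using abc mem uv by (simp add: action)
    have "\<sigma> u p \<otimes> \<tau> p u = u \<otimes> p"
      using mem by (simp add: preserve)
    also have "\<dots> = k a (s \<otimes> t)"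
      unfolding u_def p_def v_def st using abc by (simp add: product)
    also have "\<dots> = \<sigma> a s \<otimes> \<sigma> q t"
      unfolding q_def using abc mem by (simp add: product)
    finally have prod12: "\<sigma> u p \<otimes> \<tau> p u = \<sigma> a s \<otimes> \<sigma> q t" .
    then have second: "\<tau> p u = \<sigma> q t"
      using abc mem by (simp add: first closed)
    have "(u \<otimes> p) \<otimes> \<tau> c v = u \<otimes> (v \<otimes> c)"
      using abc mem preserve[of v c] by (simp add: p_def m_assoc closed)
    also have "\<dots> = a \<otimes> s \<otimes> t"
      using abc mem uv st by (simp add: m_assoc[symmetric]) (simp add: m_assoc)
    also have "\<dots> = \<sigma> a s \<otimes> (q \<otimes> t)"
      using abc mem preserve[of a s] by (simp add: q_def m_assoc[symmetric] closed)
    also have "\<dots> = (\<sigma> a s \<otimes> \<sigma> q t) \<otimes> \<tau> t q"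
      using abc mem preserve[of q t] by (simp add: m_assoc closed)
    also have "\<sigma> a s \<otimes> \<sigma> q t = u \<otimes> p"
      using mem prod12 preserve[of u p] by simp
    finally have third: "\<tau> c v = \<tau> t q"
      using abc mem by (simp add: closed)
    show ?thesis
      using abc mem first second third
      by (simp add: apply12_def apply23_def r closed
          flip: u_def v_def p_def s_def t_def q_def)
  qed
  have "r \<in> carrier G \<times> carrier G \<rightarrow> carrier G \<times> carrier G"
    by (auto simp: r closed)
  then show ?thesis
    using braid unfolding braid_solution_def by fast
qed

context left_skew_brace
begin

interpretation circ: group B
  by (fact circ_group)

interpretation add: group "add_monoid B"
  rewrites "carrier (add_monoid B) = carrier B"
    and "mult (add_monoid B) = add B"
    and "one (add_monoid B) = zero B"
    and "m_inv (add_monoid B) = a_inv B"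
  by (rule add_group) (simp_all add: a_inv_def)

lemma add_cancel_inner:
  assumes "x \<in> carrier B" "y \<in> carrier B"
  shows "\<ominus> x \<oplus> (x \<oplus> y) = y" "x \<oplus> (\<ominus> x \<oplus> y) = y"
  using assms by (simp_all add: add.m_assoc[symmetric])

lemma minus_closed [simp]:
  assumes "x \<in> carrier B" "y \<in> carrier B"
  shows "x \<ominus> y \<in> carrier B"
  using assms by (simp add: a_minus_def)

text \<open>Normalisation to reduced words in the additive group, which need not be commutative.\<close>

lemmas add_word_simps = a_minus_def add.m_assoc add.inv_mult_group add_cancel_inner

lemma zero_eq_one: "\<zero> = \<one>"
proof -
  have "\<zero> = \<ominus> \<one>"
    using left_distrib[of \<one> \<zero> \<zero>] by (simp add: a_minus_def)
  then show ?thesis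
    by (metis add.inv_one add.inv_inv circ.one_closed)
qed

lemma circ_minus:
  assumes [simp]: "a \<in> carrier B" "b \<in> carrier B"
  shows "a \<otimes> (\<ominus> b) = a \<ominus> a \<otimes> b \<oplus> a"
proof -
  have "a = a \<otimes> (b \<oplus> \<ominus> b)"
    by (simp add: zero_eq_one)
  also have "\<dots> = a \<otimes> b \<ominus> a \<oplus> a \<otimes> (\<ominus> b)"
    by (rule left_distrib) simp_all
  finally have "a \<ominus> a \<otimes> b \<oplus> a = a \<ominus> a \<otimes> b \<oplus> (a \<otimes> b \<ominus> a \<oplus> a \<otimes> (\<ominus> b))"
    by simp
  then show ?thesis
    by (simp add: add_word_simps)
qed

lemma heap_endomorphism_additive:
  assumes f_closed: "f \<in> carrier B \<rightarrow> carrier B"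
    and heap: "\<And>a b c. \<lbrakk>a \<in> carrier B; b \<in> carrier B; c \<in> carrier B\<rbrakk>
      \<Longrightarrow> f (a \<ominus> b \<oplus> c) = f a \<ominus> f b \<oplus> f c"
    and f_zero: "f \<zero> = \<zero>"
    and "a \<in> carrier B" "b \<in> carrier B"
  shows "f (a \<oplus> b) = f a \<oplus> f b" "f (\<ominus> a) = \<ominus> f a"
proof -
  have [simp]: "f x \<in> carrier B" if "x \<in> carrier B" for x
    using f_closed that by blast
  show "f (a \<oplus> b) = f a \<oplus> f b"
    using heap[of a \<zero> b] assms(4,5) by (simp add: a_minus_def f_zero)
  show "f (\<ominus> a) = \<ominus> f a"
    using heap[of \<zero> a \<zero>] assms(4) by (simp add: a_minus_def f_zero)
qed

text \<open>
  The skew brace axiom gives \<open>a \<circ> (- f b + b \<circ> c) = a - a \<circ> f b + a \<circ> b \<circ> c\<close>, and the functional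
  equation says \<open>- f a + a - a \<circ> f b = - f (a \<circ> b)\<close>; hence \<open>\<sigma>\<close> is an action.  For the product condition, put
  \<open>u = \<sigma>\<^sub>a(b)\<close> and \<open>v = \<tau>\<^sub>b(a)\<close>.  The functional equation for \<open>u \<circ> v = a \<circ> b\<close> gives
  \<open>u \<circ> \<sigma>\<^sub>v(c) = f u - f (a \<circ> b) + a \<circ> b \<circ> c\<close>, and additivity gives \<open>f u = - f (f a) + f (a \<circ> b)\<close>,
  so that the terms \<open>f (a \<circ> b)\<close> cancel.
\<close>

lemma braid_solution_minus_left:
  assumes f_closed: "f \<in> carrier B \<rightarrow> carrier B"
    and heap: "\<And>a b c. \<lbrakk>a \<in> carrier B; b \<in> carrier B; c \<in> carrier B\<rbrakk>
      \<Longrightarrow> f (a \<ominus> b \<oplus> c) = f a \<ominus> f b \<oplus> f c"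
    and f_circ: "\<And>a b. \<lbrakk>a \<in> carrier B; b \<in> carrier B\<rbrakk> \<Longrightarrow> f (a \<otimes> b) = a \<otimes> f b \<ominus> a \<oplus> f a"
    and \<sigma>: "\<And>a b. \<lbrakk>a \<in> carrier B; b \<in> carrier B\<rbrakk> \<Longrightarrow> \<sigma> a b = \<ominus> f a \<oplus> a \<otimes> b"
    and \<tau>: "\<And>a b. \<lbrakk>a \<in> carrier B; b \<in> carrier B\<rbrakk> \<Longrightarrow> \<tau> b a = inv (\<sigma> a b) \<otimes> a \<otimes> b"
    and r: "\<And>a b. \<lbrakk>a \<in> carrier B; b \<in> carrier B\<rbrakk> \<Longrightarrow> r (a, b) = (\<sigma> a b, \<tau> b a)"
  shows "braid_solution (carrier B) r"
proof -
  have f_mem [simp]: "f x \<in> carrier B" if "x \<in> carrier B" for x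
    using f_closed that by blast
  \<comment> \<open>Since \<open>1 = 0\<close>, the functional equation at \<open>1 \<circ> 1\<close> forces \<open>f 0 = 0\<close>.\<close>
  have "f \<one> = f \<one> \<ominus> \<one> \<oplus> f \<one>"
    using f_circ[of \<one> \<one>] by simp
  then have "f \<zero> = \<zero>"
    by (simp add: a_minus_def flip: zero_eq_one)
  note f_add = heap_endomorphism_additive[OF f_closed heap this]
  have \<sigma>_closed: "\<sigma> a b \<in> carrier B" if "a \<in> carrier B" "b \<in> carrier B" for a b
    using that by (simp add: \<sigma>)
  have circ_\<sigma>: "a \<otimes> (\<ominus> f b \<oplus> y) = a \<ominus> a \<otimes> f b \<oplus> a \<otimes> y"
    if "a \<in> carrier B" "b \<in> carrier B" "y \<in> carrier B" for a b y
    using that by (simp add: a_minus_def left_distrib circ_minus) (simp add: add_word_simps)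
  have action: "\<sigma> a (\<sigma> b c) = \<sigma> (a \<otimes> b) c"
    if "a \<in> carrier B" "b \<in> carrier B" "c \<in> carrier B" for a b c
    using that by (simp add: \<sigma> \<sigma>_closed[unfolded \<sigma>] circ_\<sigma> f_circ)
      (simp add: add_word_simps circ.m_assoc)
  define k where "k = (\<lambda>a x. \<ominus> f (f a) \<oplus> a \<otimes> x)"
  have product: "\<sigma> a b \<otimes> \<sigma> (\<tau> b a) c = k a (b \<otimes> c)"
    if abc: "a \<in> carrier B" "b \<in> carrier B" "c \<in> carrier B" for a b c
  proof -
    define u v where "u = \<sigma> a b" and "v = \<tau> b a"
    have mem: "u \<in> carrier B" "v \<in> carrier B"
      using abc by (simp_all add: u_def v_def \<tau> \<sigma>_closed)
    have uv: "u \<otimes> v = a \<otimes> b"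
      unfolding u_def v_def using abc by (simp add: \<tau> \<sigma>_closed circ.m_assoc[symmetric])
    have "u \<otimes> \<sigma> v c = f u \<ominus> f (u \<otimes> v) \<oplus> u \<otimes> v \<otimes> c"
      using abc mem by (simp add: \<sigma> circ_\<sigma> f_circ) (simp add: add_word_simps circ.m_assoc)
    also have "u \<otimes> v = a \<otimes> b"
      by (fact uv)
    also have "f u = \<ominus> f (f a) \<oplus> f (a \<otimes> b)"
      unfolding u_def using abc by (simp add: \<sigma> a_minus_def f_add)
    finally show ?thesis
      using abc by (simp add: k_def u_def v_def add_word_simps circ.m_assoc)
  qed
  show ?thesis
    by (rule circ.braid_solution_of_action[where \<sigma> = \<sigma> and \<tau> = \<tau> and k = k])
      (fact \<sigma>_closed action \<tau> product r)+
qed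

text \<open>
  The mirror image of the preceding lemma under reversal of the addition: here
  \<open>u \<circ> \<sigma>\<^sub>v(c) = a \<circ> b \<circ> c - f (a \<circ> b) + f u\<close> with \<open>f u = f (a \<circ> b) - f (f a)\<close>.
\<close>

lemma braid_solution_minus_right:
  assumes f_closed: "f \<in> carrier B \<rightarrow> carrier B"
    and heap: "\<And>a b c. \<lbrakk>a \<in> carrier B; b \<in> carrier B; c \<in> carrier B\<rbrakk>
      \<Longrightarrow> f (a \<ominus> b \<oplus> c) = f a \<ominus> f b \<oplus> f c"
    and f_circ: "\<And>a b. \<lbrakk>a \<in> carrier B; b \<in> carrier B\<rbrakk> \<Longrightarrow> f (a \<otimes> b) = f a \<ominus> a \<oplus> a \<otimes> f b"
    and \<sigma>: "\<And>a b. \<lbrakk>a \<in> carrier B; b \<in> carrier B\<rbrakk> \<Longrightarrow> \<sigma> a b = a \<otimes> b \<ominus> f a"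
    and \<tau>: "\<And>a b. \<lbrakk>a \<in> carrier B; b \<in> carrier B\<rbrakk> \<Longrightarrow> \<tau> b a = inv (\<sigma> a b) \<otimes> a \<otimes> b"
    and r: "\<And>a b. \<lbrakk>a \<in> carrier B; b \<in> carrier B\<rbrakk> \<Longrightarrow> r (a, b) = (\<sigma> a b, \<tau> b a)"
  shows "braid_solution (carrier B) r"
proof -
  have f_mem [simp]: "f x \<in> carrier B" if "x \<in> carrier B" for x
    using f_closed that by blast
  \<comment> \<open>Since \<open>1 = 0\<close>, the functional equation at \<open>1 \<circ> 1\<close> forces \<open>f 0 = 0\<close>.\<close>
  have "f \<one> = f \<one> \<ominus> \<one> \<oplus> f \<one>"
    using f_circ[of \<one> \<one>] by simp
  then have "f \<zero> = \<zero>"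
    by (simp add: a_minus_def flip: zero_eq_one)
  note f_add = heap_endomorphism_additive[OF f_closed heap this]
  have \<sigma>_closed: "\<sigma> a b \<in> carrier B" if "a \<in> carrier B" "b \<in> carrier B" for a b
    using that by (simp add: \<sigma>)
  have circ_\<sigma>: "a \<otimes> (y \<ominus> f b) = a \<otimes> y \<ominus> a \<otimes> f b \<oplus> a"
    if "a \<in> carrier B" "b \<in> carrier B" "y \<in> carrier B" for a b y
    using that by (simp add: a_minus_def left_distrib circ_minus) (simp add: add_word_simps)
  have action: "\<sigma> a (\<sigma> b c) = \<sigma> (a \<otimes> b) c"
    if "a \<in> carrier B" "b \<in> carrier B" "c \<in> carrier B" for a b c
    using that by (simp add: \<sigma> \<sigma>_closed[unfolded \<sigma>] circ_\<sigma> f_circ)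
      (simp add: add_word_simps circ.m_assoc)
  define k where "k = (\<lambda>a x. a \<otimes> x \<ominus> f (f a))"
  have product: "\<sigma> a b \<otimes> \<sigma> (\<tau> b a) c = k a (b \<otimes> c)"
    if abc: "a \<in> carrier B" "b \<in> carrier B" "c \<in> carrier B" for a b c
  proof -
    define u v where "u = \<sigma> a b" and "v = \<tau> b a"
    have mem: "u \<in> carrier B" "v \<in> carrier B"
      using abc by (simp_all add: u_def v_def \<tau> \<sigma>_closed)
    have uv: "u \<otimes> v = a \<otimes> b"
      unfolding u_def v_def using abc by (simp add: \<tau> \<sigma>_closed circ.m_assoc[symmetric])
    have "u \<otimes> \<sigma> v c = u \<otimes> v \<otimes> c \<ominus> f (u \<otimes> v) \<oplus> f u"
      using abc mem by (simp add: \<sigma> circ_\<sigma> f_circ) (simp add: add_word_simps circ.m_assoc)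
    also have "u \<otimes> v = a \<otimes> b"
      by (fact uv)
    also have "f u = f (a \<otimes> b) \<ominus> f (f a)"
      unfolding u_def using abc by (simp add: \<sigma> a_minus_def f_add)
    finally show ?thesis
      using abc by (simp add: k_def u_def v_def add_word_simps circ.m_assoc)
  qed
  show ?thesis
    by (rule circ.braid_solution_of_action[where \<sigma> = \<sigma> and \<tau> = \<tau> and k = k])
      (fact \<sigma>_closed action \<tau> product r)+
qed

end

theorem corollary5p28:
  fixes X :: "('a, 'm) ring_scheme" (structure)
    and f :: "'a \<Rightarrow> 'a"
    and \<sigma> \<tau> :: "'a \<Rightarrow> 'a \<Rightarrow> 'a"
    and r :: "'a \<times> 'a \<Rightarrow> 'a \<times> 'a"
  assumes "skew_brace X"
    and "bij_betw f (carrier X) (carrier X)"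
    and "\<forall>a \<in> carrier X. \<forall>b \<in> carrier X. \<forall>c \<in> carrier X.
           f (a \<ominus> b \<oplus> c) = f a \<ominus> f b \<oplus> f c"
    and "((\<forall>a \<in> carrier X. \<forall>b \<in> carrier X. \<sigma> a b = (\<ominus> (f a)) \<oplus> (a \<otimes> b)) \<and>
          (\<forall>a \<in> carrier X. \<forall>b \<in> carrier X. f (a \<otimes> b) = a \<otimes> f b \<ominus> a \<oplus> f a))
       \<or> ((\<forall>a \<in> carrier X. \<forall>b \<in> carrier X. \<sigma> a b = a \<otimes> b \<ominus> f a) \<and>
          (\<forall>a \<in> carrier X. \<forall>b \<in> carrier X. f (a \<otimes> b) = f a \<ominus> a \<oplus> a \<otimes> f b))"
    and "\<forall>a \<in> carrier X. \<forall>b \<in> carrier X. \<tau> b a = inv (\<sigma> a b) \<otimes> a \<otimes> b"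
    and "\<forall>a \<in> carrier X. \<forall>b \<in> carrier X. r (a, b) = (\<sigma> a b, \<tau> b a)"
  shows "braid_solution (carrier X) r"
proof -
  interpret skew_brace X
    by (fact assms(1))
  have f_closed: "f \<in> carrier X \<rightarrow> carrier X"
    using assms(2) by (auto dest: bij_betwE)
  from assms(4) show ?thesis
  proof (elim disjE conjE)
    assume "\<forall>a \<in> carrier X. \<forall>b \<in> carrier X. \<sigma> a b = (\<ominus> (f a)) \<oplus> (a \<otimes> b)"
      and "\<forall>a \<in> carrier X. \<forall>b \<in> carrier X. f (a \<otimes> b) = a \<otimes> f b \<ominus> a \<oplus> f a"
    then show ?thesis
      by (intro braid_solution_minus_left[where \<sigma> = \<sigma> and \<tau> = \<tau>, OF f_closed])
        (simp_all add: assms(3,5,6))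
  next
    assume "\<forall>a \<in> carrier X. \<forall>b \<in> carrier X. \<sigma> a b = a \<otimes> b \<ominus> f a"
      and "\<forall>a \<in> carrier X. \<forall>b \<in> carrier X. f (a \<otimes> b) = f a \<ominus> a \<oplus> a \<otimes> f b"
    then show ?thesis
      by (intro braid_solution_minus_right[where \<sigma> = \<sigma> and \<tau> = \<tau>, OF f_closed])
        (simp_all add: assms(3,5,6))
  qed
qed

end
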